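(* Let $A$ be a skew left brace. If $M$ is a maximal ideal of $A$, then $[A,A]_+ + A^{(2)}\subseteq M$ or $\operatorname{Soc}(A)\subseteq M$. In particular, $A^{(2)}\cap\operatorname{Soc}(A)\subseteq\operatorname{Rad}(A)$.
   Context: A skew left brace is a triple $(A,+,\circ)$ where $(A,+)$ and $(A,\circ)$ are (not necessarily abelian) groups with $a\circ(b+c)=a\circ b-a+a\circ c$ for all $a,b,c\in A$. The map $\lambda\colon(A,\circ)\to\operatorname{Aut}(A,+)$, $\lambda_a(b)=-a+a\circ b$, is a group homomorphism; put $a*b=\lambda_a(b)-b=-a+a\circ b-b$. An ideal of $A$ is a subgroup $I$ of $(A,+)$ that is normal in $(A,+)$, satisfies $\lambda_a(I)\subseteq I$ for all $a\in A$, and is a normal subgroup of $(A,\circ)$. A maximal ideal is a proper ideal not contained in any other proper ideal. $\operatorname{Rad}(A)$ is the intersection of all maximal ideals of $A$ if such exist, and $A$ otherwise. $A^{(2)}$ is the additive subgroup generated by all $a*b$ with $a,b\in A$ (it is an ideal). $[A,A]_+$ is the commutator subgroup of $(A,+)$. The socle is $\operatorname{Soc}(A)=\ker\lambda\cap Z(A,+)$, where $Z(A,+)$ is the center of $(A,+)$. *)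

theory Defs
  imports "HOL-Algebra.Algebra"
begin

text \<open>
  A triple \<open>(A, +, \<circ>)\<close> is carried by the library's ring record: \<open>\<oplus>\<close> is the
  (not necessarily commutative) addition and \<open>\<otimes>\<close> is \<open>\<circ>\<close>, so \<open>add_monoid A\<close> is \<open>(A, +)\<close>
  and \<open>A\<close>, viewed as a monoid, is \<open>(A, \<circ>)\<close>. None of the ring axioms is assumed.
\<close>

locale skew_left_brace = group A + add: group "add_monoid A"
  for A :: "('a, 'm) ring_scheme" (structure) +
  assumes brace: "\<lbrakk>a \<in> carrier A; b \<in> carrier A; c \<in> carrier A\<rbrakk>
    \<Longrightarrow> a \<otimes> (b \<oplus> c) = a \<otimes> b \<oplus> \<ominus> a \<oplus> a \<otimes> c"

text \<open>Restricted to the carrier because the elements of \<open>AutoGroup\<close> are extensional functions.\<close>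

definition brace_lambda :: "('a, 'm) ring_scheme \<Rightarrow> 'a \<Rightarrow> 'a \<Rightarrow> 'a" where
  "brace_lambda A a = (\<lambda>b\<in>carrier A. \<ominus>\<^bsub>A\<^esub> a \<oplus>\<^bsub>A\<^esub> a \<otimes>\<^bsub>A\<^esub> b)"

definition brace_star :: "('a, 'm) ring_scheme \<Rightarrow> 'a \<Rightarrow> 'a \<Rightarrow> 'a" where
  "brace_star A a b = brace_lambda A a b \<ominus>\<^bsub>A\<^esub> b"

definition brace_ideal :: "('a, 'm) ring_scheme \<Rightarrow> 'a set \<Rightarrow> bool" where
  "brace_ideal A I \<longleftrightarrow>
     I \<lhd> add_monoid A \<and> (\<forall>a\<in>carrier A. brace_lambda A a ` I \<subseteq> I) \<and> I \<lhd> A"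

definition brace_maximal_ideal :: "('a, 'm) ring_scheme \<Rightarrow> 'a set \<Rightarrow> bool" where
  "brace_maximal_ideal A M \<longleftrightarrow>
     brace_ideal A M \<and> M \<noteq> carrier A \<and>
     (\<forall>I. brace_ideal A I \<and> I \<noteq> carrier A \<and> M \<subseteq> I \<longrightarrow> I = M)"

definition brace_Rad :: "('a, 'm) ring_scheme \<Rightarrow> 'a set" where
  "brace_Rad A =
     (if \<exists>M. brace_maximal_ideal A M then \<Inter>{M. brace_maximal_ideal A M} else carrier A)"

definition brace_square :: "('a, 'm) ring_scheme \<Rightarrow> 'a set" where
  "brace_square A =
     generate (add_monoid A) {brace_star A a b | a b. a \<in> carrier A \<and> b \<in> carrier A}"

definition group_center :: "('a, 'm) monoid_scheme \<Rightarrow> 'a set" where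
  "group_center G = {z \<in> carrier G. \<forall>x\<in>carrier G. z \<otimes>\<^bsub>G\<^esub> x = x \<otimes>\<^bsub>G\<^esub> z}"

definition brace_Soc :: "('a, 'm) ring_scheme \<Rightarrow> 'a set" where
  "brace_Soc A =
     kernel A (AutoGroup (add_monoid A)) (brace_lambda A) \<inter> group_center (add_monoid A)"

end

theory Submission
  imports Defs
begin

text \<open>
  If \<open>Soc(A)\<close> is not contained in the maximal ideal \<open>M\<close>, then the ideal \<open>M + Soc(A)\<close> is all of \<open>A\<close>.
  Since a socle element \<open>s\<close> is additively central and satisfies \<open>s \<circ> b = s + b\<close>, this makes the
  quotient \<open>A/M\<close> additively abelian with trivial \<open>\<lambda>\<close>, so \<open>M\<close> contains all commutators and
  all \<open>a * b\<close>.
\<close>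

context skew_left_brace
begin

section \<open>Calculation in the additive group\<close>

lemmas add_record_simps = monoid.simps partial_object.simps
text \<open>The facts of the locale \<open>add\<close> speak of the operations of
  \<open>add_monoid A\<close>. Reducing the record projections and folding \<open>a_inv_def\<close>
  restates them with \<open>\<oplus>\<close>, \<open>\<zero>\<close> and
  \<open>\<ominus>\<close>.\<close>

lemmas plus_assoc = add.m_assoc [simplified add_record_simps]
lemmas plus_closed = add.m_closed [simplified add_record_simps]
lemmas zero_mem = add.one_closed [simplified add_record_simps]
lemmas minus_mem = add.inv_closed [simplified add_record_simps, folded a_inv_def]
lemmas plus_zero = add.r_one [simplified add_record_simps]
lemmas zero_plus = add.l_one [simplified add_record_simps]
lemmas plus_minus = add.r_inv [simplified add_record_simps, folded a_inv_def]
lemmas minus_plus = add.l_inv [simplified add_record_simps, folded a_inv_def]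
lemmas minus_minus = add.inv_inv [simplified add_record_simps, folded a_inv_def]
lemmas minus_add = add.inv_mult_group [simplified add_record_simps, folded a_inv_def]

lemma plus_minus_cancel: "\<lbrakk>a \<in> carrier A; b \<in> carrier A\<rbrakk> \<Longrightarrow> a \<oplus> (\<ominus> a \<oplus> b) = b"
  by (metis plus_assoc minus_mem plus_minus zero_plus)

lemma minus_plus_cancel: "\<lbrakk>a \<in> carrier A; b \<in> carrier A\<rbrakk> \<Longrightarrow> \<ominus> a \<oplus> (a \<oplus> b) = b"
  by (metis plus_assoc minus_mem minus_plus zero_plus)

text \<open>Nests sums to the right and cancels inverse pairs without using commutativity. The two
  cancellation lemmas reach pairs that are followed by further summands.\<close>

lemmas plus_simps = plus_assoc plus_closed zero_mem minus_mem plus_zero zero_plus plus_minus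
  minus_plus minus_minus minus_add plus_minus_cancel minus_plus_cancel

lemma normal_add_invE:
  assumes "N \<lhd> add_monoid A" "x \<in> carrier A" "h \<in> N"
  shows "x \<oplus> h \<oplus> \<ominus> x \<in> N"
  using add.normal_invE(2)[OF assms(1)] assms(2,3) by (simp add: a_inv_def)

lemma normal_add_invI:
  assumes "subgroup N (add_monoid A)"
    and "\<And>x h. \<lbrakk>x \<in> carrier A; h \<in> N\<rbrakk> \<Longrightarrow> x \<oplus> h \<oplus> \<ominus> x \<in> N"
  shows "N \<lhd> add_monoid A"
  using assms by (intro add.normal_invI) (simp_all add: a_inv_def)

lemma subgroup_addI:
  assumes "H \<subseteq> carrier A" "\<zero> \<in> H" "\<And>x. x \<in> H \<Longrightarrow> \<ominus> x \<in> H"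
    and "\<And>x y. \<lbrakk>x \<in> H; y \<in> H\<rbrakk> \<Longrightarrow> x \<oplus> y \<in> H"
  shows "subgroup H (add_monoid A)"
  using assms by (intro add.subgroupI) (auto simp: a_inv_def)

lemma subgroup_addE:
  assumes "subgroup H (add_monoid A)"
  shows "H \<subseteq> carrier A" "\<zero> \<in> H" "\<And>x. x \<in> H \<Longrightarrow> \<ominus> x \<in> H"
    and "\<And>x y. \<lbrakk>x \<in> H; y \<in> H\<rbrakk> \<Longrightarrow> x \<oplus> y \<in> H"
  using subgroup.subset[OF assms] subgroup.one_closed[OF assms]
    subgroup.m_inv_closed[OF assms] subgroup.m_closed[OF assms] by (auto simp: a_inv_def)

section \<open>The map \<open>\<lambda>\<close>\<close>

lemma lambda_eq: "b \<in> carrier A \<Longrightarrow> brace_lambda A a b = \<ominus> a \<oplus> a \<otimes> b"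
  by (simp add: brace_lambda_def)

lemma lambda_closed: "\<lbrakk>a \<in> carrier A; b \<in> carrier A\<rbrakk> \<Longrightarrow> brace_lambda A a b \<in> carrier A"
  by (simp add: lambda_eq plus_simps)

lemma mult_eq: "\<lbrakk>a \<in> carrier A; b \<in> carrier A\<rbrakk> \<Longrightarrow> a \<otimes> b = a \<oplus> brace_lambda A a b"
  by (simp add: lambda_eq plus_simps)

lemma lambda_add:
  assumes "a \<in> carrier A" "b \<in> carrier A" "c \<in> carrier A"
  shows "brace_lambda A a (b \<oplus> c) = brace_lambda A a b \<oplus> brace_lambda A a c"
  using assms by (simp add: lambda_eq plus_simps brace)

lemma mult_zero: "a \<in> carrier A \<Longrightarrow> a \<otimes> \<zero> = a"
proof -
  assume a: "a \<in> carrier A"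
  \<comment> \<open>The brace identity at \<open>b = c = \<zero>\<close>; cancelling
    \<open>a \<otimes> \<zero>\<close> on the left leaves
    \<open>\<ominus> a \<oplus> a \<otimes> \<zero> = \<zero>\<close>.\<close>
  have "a \<otimes> \<zero> = a \<otimes> \<zero> \<oplus> (\<ominus> a \<oplus> a \<otimes> \<zero>)"
    using brace[OF a zero_mem zero_mem] a by (simp add: plus_simps)
  then have "\<ominus> a \<oplus> a \<otimes> \<zero> = \<zero>"
    using a by (metis m_closed minus_plus minus_plus_cancel minus_mem plus_closed zero_mem)
  then show ?thesis
    using a by (metis m_closed plus_minus_cancel plus_zero zero_mem)
qed

lemma one_eq_zero: "\<one> = \<zero>"
  using mult_zero[OF one_closed] zero_mem by simp

text \<open>Associativity of \<open>\<otimes>\<close>: expanding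
  \<open>a \<otimes> b \<otimes> c\<close> with \<open>mult_eq\<close> in both bracketings gives two
  sums that start with \<open>a \<otimes> b\<close>, which cancels.\<close>

lemma lambda_mult:
  assumes "a \<in> carrier A" "b \<in> carrier A" "c \<in> carrier A"
  shows "brace_lambda A (a \<otimes> b) c = brace_lambda A a (brace_lambda A b c)"
proof -
  have "(a \<otimes> b) \<oplus> brace_lambda A (a \<otimes> b) c = a \<otimes> (b \<oplus> brace_lambda A b c)"
    using assms by (metis m_assoc m_closed mult_eq)
  also have "\<dots> = (a \<otimes> b) \<oplus> brace_lambda A a (brace_lambda A b c)"
    using assms by (simp add: mult_eq lambda_add lambda_closed plus_simps)
  finally show ?thesis
    using assms by (metis lambda_closed m_closed minus_plus_cancel)
qed

lemma lambda_one: "b \<in> carrier A \<Longrightarrow> brace_lambda A \<one> b = b"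
  by (metis l_one lambda_closed mult_eq one_closed one_eq_zero zero_plus)

section \<open>The socle is an ideal\<close>

lemma Soc_iff:
  "s \<in> brace_Soc A \<longleftrightarrow> s \<in> carrier A \<and>
     (\<forall>b\<in>carrier A. brace_lambda A s b = b \<and> s \<oplus> b = b \<oplus> s)"
proof -
  \<comment> \<open>The unit of \<open>AutoGroup\<close> is the identity restricted to the carrier,
    and \<open>brace_lambda A s\<close> is restricted in the same way, so their equality is
    pointwise equality on the carrier.\<close>
  have "brace_lambda A s = \<one>\<^bsub>AutoGroup (add_monoid A)\<^esub> \<longleftrightarrow>
      (\<forall>b\<in>carrier A. brace_lambda A s b = b)"
    by (auto simp: AutoGroup_def BijGroup_def brace_lambda_def restrict_def fun_eq_iff)
  then show ?thesis
    by (auto simp: brace_Soc_def kernel_def group_center_def)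
qed

lemma Soc_carrier: "s \<in> brace_Soc A \<Longrightarrow> s \<in> carrier A"
  by (simp add: Soc_iff)

lemma Soc_lambda: "\<lbrakk>s \<in> brace_Soc A; b \<in> carrier A\<rbrakk> \<Longrightarrow> brace_lambda A s b = b"
  by (simp add: Soc_iff)

lemma Soc_comm: "\<lbrakk>s \<in> brace_Soc A; b \<in> carrier A\<rbrakk> \<Longrightarrow> s \<oplus> b = b \<oplus> s"
  by (simp add: Soc_iff)

lemma Soc_mult: "\<lbrakk>s \<in> brace_Soc A; b \<in> carrier A\<rbrakk> \<Longrightarrow> s \<otimes> b = s \<oplus> b"
  by (simp add: mult_eq Soc_lambda Soc_carrier)

lemma zero_Soc: "\<zero> \<in> brace_Soc A"
  using lambda_one zero_mem by (auto simp: Soc_iff one_eq_zero plus_zero zero_plus)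

lemma add_Soc:
  assumes "s \<in> brace_Soc A" "t \<in> brace_Soc A"
  shows "s \<oplus> t \<in> brace_Soc A"
proof -
  \<comment> \<open>Since \<open>s \<oplus> t = s \<otimes> t\<close>, multiplicativity of
    \<open>\<lambda>\<close> applies.\<close>
  have "brace_lambda A (s \<oplus> t) b = b" if "b \<in> carrier A" for b
    using assms that by (simp add: Soc_mult[symmetric] lambda_mult Soc_lambda Soc_carrier)
  moreover have "(s \<oplus> t) \<oplus> b = b \<oplus> (s \<oplus> t)" if b: "b \<in> carrier A" for b
  proof -
    have "(s \<oplus> t) \<oplus> b = s \<oplus> b \<oplus> t"
      using assms b Soc_comm[OF assms(2) b] by (simp add: plus_assoc Soc_carrier)
    also have "\<dots> = b \<oplus> (s \<oplus> t)"
      using assms b Soc_comm[OF assms(1) b] by (simp add: plus_assoc Soc_carrier)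
    finally show ?thesis .
  qed
  ultimately show ?thesis
    using plus_closed[OF Soc_carrier[OF assms(1)] Soc_carrier[OF assms(2)]]
    unfolding Soc_iff by blast
qed

text \<open>By \<open>Soc_mult\<close>,
  \<open>s \<otimes> \<ominus> s = s \<oplus> \<ominus> s\<close>, which is the common neutral
  element. Hence closure under one kind of inverse gives closure under the other.\<close>

lemma inv_Soc:
  assumes s: "s \<in> brace_Soc A"
  shows "inv s = \<ominus> s"
proof -
  have sc: "s \<in> carrier A" using s by (rule Soc_carrier)
  have "s \<otimes> \<ominus> s = \<one>"
    using s sc by (simp add: Soc_mult plus_simps one_eq_zero)
  then show ?thesis
    using inv_equality[OF inv_comm] sc minus_mem[OF sc] by blast
qed

lemma minus_Soc:
  assumes s: "s \<in> brace_Soc A"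
  shows "\<ominus> s \<in> brace_Soc A"
proof -
  have sc: "s \<in> carrier A" using s by (rule Soc_carrier)
  have "brace_lambda A (\<ominus> s) b = b" if b: "b \<in> carrier A" for b
  proof -
    \<comment> \<open>\<open>\<lambda>\<close> of \<open>s\<close> fixes \<open>b\<close>, so it can
      be inserted and then cancels against \<open>\<lambda>\<close> of \<open>inv s\<close>.\<close>
    have "brace_lambda A (\<ominus> s) b = brace_lambda A (inv s) (brace_lambda A s b)"
      using s b by (simp add: inv_Soc Soc_lambda)
    also have "\<dots> = b"
      using sc b by (simp add: lambda_mult[symmetric] lambda_one)
    finally show ?thesis .
  qed
  moreover have "\<ominus> s \<oplus> b = b \<oplus> \<ominus> s" if b: "b \<in> carrier A" for b
  proof -
    have "\<ominus> s \<oplus> b = \<ominus> s \<oplus> (b \<oplus> s) \<oplus> \<ominus> s" using sc b by (simp add: plus_simps)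
    also have "\<dots> = \<ominus> s \<oplus> (s \<oplus> b) \<oplus> \<ominus> s" using Soc_comm[OF s b] by simp
    also have "\<dots> = b \<oplus> \<ominus> s" using sc b by (simp add: plus_simps)
    finally show ?thesis .
  qed
  ultimately show ?thesis
    using minus_mem[OF sc] unfolding Soc_iff by blast
qed

lemma lambda_Soc_central:
  assumes a: "a \<in> carrier A" and s: "s \<in> brace_Soc A" and b: "b \<in> carrier A"
  shows "brace_lambda A a s \<oplus> b = b \<oplus> brace_lambda A a s"
proof -
  \<comment> \<open>The preimage of \<open>b\<close> under \<open>\<lambda>\<close> of
    \<open>a\<close>: an additive map onto the whole group sends central elements to central
    elements.\<close>
  let ?c = "brace_lambda A (inv a) b"
  have c: "?c \<in> carrier A" using a b by (simp add: lambda_closed)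
  have "b = brace_lambda A a ?c"
    using a b by (simp add: lambda_mult[symmetric] lambda_one)
  then show ?thesis
    using Soc_comm[OF s c] lambda_add[OF a Soc_carrier[OF s] c]
      lambda_add[OF a c Soc_carrier[OF s]] by simp
qed

text \<open>Links the two remaining closure properties of an ideal: for the socle, normality in the
  group \<open>\<otimes>\<close> and invariance under \<open>\<lambda>\<close> become the same
  statement.\<close>

lemma conj_Soc_eq_lambda:
  assumes a: "a \<in> carrier A" and s: "s \<in> brace_Soc A"
  shows "a \<otimes> s \<otimes> inv a = brace_lambda A a s"
proof -
  have sc: "s \<in> carrier A" using s by (rule Soc_carrier)
  have "a \<otimes> s \<otimes> inv a = a \<otimes> (s \<oplus> inv a)"
    using a s sc by (simp add: m_assoc Soc_mult)
  \<comment> \<open>The brace identity leaves a last summand \<open>a \<otimes> inv a\<close>, which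
    is \<open>\<one> = \<zero>\<close>.\<close>
  also have "\<dots> = a \<otimes> s \<oplus> \<ominus> a"
    using a sc by (simp add: brace plus_simps one_eq_zero)
  also have "\<dots> = brace_lambda A a s \<oplus> a \<oplus> \<ominus> a"
    using a sc lambda_Soc_central[OF a s a] by (simp add: mult_eq)
  also have "\<dots> = brace_lambda A a s"
    using a sc by (simp add: lambda_closed plus_simps)
  finally show ?thesis .
qed

lemma lambda_Soc:
  assumes a: "a \<in> carrier A" and s: "s \<in> brace_Soc A"
  shows "brace_lambda A a s \<in> brace_Soc A"
proof -
  have sc: "s \<in> carrier A" using s by (rule Soc_carrier)
  have "brace_lambda A (brace_lambda A a s) b = b" if b: "b \<in> carrier A" for b
  proof -
    \<comment> \<open>The kernel of \<open>\<lambda>\<close> is closed under conjugation, and the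
      conjugate is the element in question by \<open>conj_Soc_eq_lambda\<close>.\<close>
    have "brace_lambda A (a \<otimes> s \<otimes> inv a) b = brace_lambda A a (brace_lambda A (inv a) b)"
      using a s sc b by (simp add: lambda_mult Soc_lambda lambda_closed)
    also have "\<dots> = b"
      using a b by (simp add: lambda_mult[symmetric] lambda_one)
    finally show ?thesis by (simp add: conj_Soc_eq_lambda[OF a s])
  qed
  then show ?thesis
    using lambda_Soc_central[OF a s] lambda_closed[OF a sc] by (simp add: Soc_iff)
qed

lemma Soc_ideal: "brace_ideal A (brace_Soc A)"
proof -
  have "subgroup (brace_Soc A) (add_monoid A)"
    using Soc_carrier zero_Soc minus_Soc add_Soc by (intro subgroup_addI) auto
  then have "brace_Soc A \<lhd> add_monoid A"
  proof (rule normal_add_invI)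
    fix x h assume x: "x \<in> carrier A" and h: "h \<in> brace_Soc A"
    have "x \<oplus> h \<oplus> \<ominus> x = h"
      using Soc_comm[OF h x, symmetric] x Soc_carrier[OF h] by (simp add: plus_simps)
    then show "x \<oplus> h \<oplus> \<ominus> x \<in> brace_Soc A" using h by simp
  qed
  moreover have "subgroup (brace_Soc A) A"
    using zero_Soc by (intro subgroupI)
      (auto simp: Soc_carrier inv_Soc minus_Soc Soc_mult add_Soc)
  then have "brace_Soc A \<lhd> A"
    by (rule normal_invI) (simp add: conj_Soc_eq_lambda lambda_Soc)
  ultimately show ?thesis
    using lambda_Soc by (auto simp: brace_ideal_def)
qed

section \<open>Enlarging an ideal by the socle\<close>

lemma ideal_add_Soc:
  assumes M: "brace_ideal A M"
  shows "brace_ideal A (M <+>\<^bsub>A\<^esub> brace_Soc A)"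
proof -
  have Mn: "M \<lhd> add_monoid A" "M \<lhd> A"
    and Ml: "\<And>a m. \<lbrakk>a \<in> carrier A; m \<in> M\<rbrakk> \<Longrightarrow> brace_lambda A a m \<in> M"
    using M by (auto simp: brace_ideal_def)
  have Mc: "m \<in> carrier A" if "m \<in> M" for m
    using that normal_imp_subgroup[OF Mn(2)] subgroup.subset by auto
  have Sn: "brace_Soc A \<lhd> add_monoid A" "brace_Soc A \<lhd> A"
    using Soc_ideal by (auto simp: brace_ideal_def)
  \<comment> \<open>Identifies the sum set with a product set for \<open>\<otimes>\<close>, so that
    normality in both groups follows from the closure of normal subgroups under set
    products.\<close>
  have "m \<oplus> s = s \<otimes> m" if "m \<in> M" "s \<in> brace_Soc A" for m s
    using that by (simp add: Soc_mult Mc Soc_comm)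
  then have "M <+>\<^bsub>A\<^esub> brace_Soc A = brace_Soc A <#> M"
    by (force simp: set_add_def set_mult_def)
  then have "M <+>\<^bsub>A\<^esub> brace_Soc A \<lhd> A"
    using normal_subgroup_set_mult_closed[OF Sn(2) Mn(2)] by simp
  moreover have "M <+>\<^bsub>A\<^esub> brace_Soc A \<lhd> add_monoid A"
    using add.normal_subgroup_set_mult_closed[OF Mn(1) Sn(1)] by (simp add: set_add_def)
  moreover have "brace_lambda A a (m \<oplus> s) \<in> M <+>\<^bsub>A\<^esub> brace_Soc A"
    if "a \<in> carrier A" "m \<in> M" "s \<in> brace_Soc A" for a m s
  proof -
    have "brace_lambda A a (m \<oplus> s) = brace_lambda A a m \<oplus> brace_lambda A a s"
      using that by (simp add: lambda_add Mc Soc_carrier)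
    then show ?thesis
      using Ml[OF that(1,2)] lambda_Soc[OF that(1,3)] by (auto simp: set_add_def set_mult_def)
  qed
  ultimately show ?thesis
    by (auto simp: brace_ideal_def set_add_def set_mult_def)
qed

lemma maximal_ideal_add_Soc:
  assumes M: "brace_maximal_ideal A M" and "\<not> brace_Soc A \<subseteq> M"
  shows "M <+>\<^bsub>A\<^esub> brace_Soc A = carrier A"
proof -
  have id: "brace_ideal A M" using M by (simp add: brace_maximal_ideal_def)
  then have sub: "subgroup M (add_monoid A)"
    using normal_imp_subgroup by (auto simp: brace_ideal_def)
  note E = subgroup_addE[OF sub]
  have "M \<subseteq> M <+>\<^bsub>A\<^esub> brace_Soc A"
  proof
    fix m assume m: "m \<in> M"
    then have "m = m \<oplus> \<zero>" using E(1) by (auto simp: plus_simps)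
    then show "m \<in> M <+>\<^bsub>A\<^esub> brace_Soc A"
      using m zero_Soc by (auto simp: set_add_def set_mult_def)
  qed
  moreover have "brace_Soc A \<subseteq> M <+>\<^bsub>A\<^esub> brace_Soc A"
  proof
    fix s assume s: "s \<in> brace_Soc A"
    then have "s = \<zero> \<oplus> s" using Soc_carrier by (auto simp: plus_simps)
    then show "s \<in> M <+>\<^bsub>A\<^esub> brace_Soc A"
      using s E(2) by (auto simp: set_add_def set_mult_def)
  qed
  ultimately show ?thesis
    using M ideal_add_Soc[OF id] assms(2) unfolding brace_maximal_ideal_def by blast
qed

section \<open>Commutators and star products modulo the ideal\<close>

lemma commutator_mem_ideal:
  assumes M: "brace_ideal A M" and full: "M <+>\<^bsub>A\<^esub> brace_Soc A = carrier A"
    and a: "a \<in> carrier A" and b: "b \<in> carrier A"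
  shows "a \<oplus> b \<oplus> \<ominus> a \<oplus> \<ominus> b \<in> M"
proof -
  have n: "M \<lhd> add_monoid A" using M by (simp add: brace_ideal_def)
  note E = subgroup_addE[OF normal_imp_subgroup[OF n]]
  obtain m s where ms: "m \<in> M" "s \<in> brace_Soc A" "a = m \<oplus> s"
    using a unfolding full[symmetric] by (auto simp: set_add_def set_mult_def)
  have mc: "m \<in> carrier A" and sc: "s \<in> carrier A" using ms E(1) Soc_carrier by auto
  \<comment> \<open>The central part \<open>s\<close> of \<open>a\<close> drops out of the
    conjugation of \<open>b\<close>.\<close>
  have "a \<oplus> b \<oplus> \<ominus> a = m \<oplus> (s \<oplus> b) \<oplus> \<ominus> s \<oplus> \<ominus> m"
    using mc sc b ms(3) by (simp add: plus_simps)
  also have "\<dots> = m \<oplus> b \<oplus> \<ominus> m"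
    using mc sc b Soc_comm[OF ms(2) b] by (simp add: plus_simps)
  \<comment> \<open>Regrouped as \<open>m\<close> plus a conjugate of \<open>\<ominus> m\<close>;
    both lie in \<open>M\<close>.\<close>
  finally have "a \<oplus> b \<oplus> \<ominus> a \<oplus> \<ominus> b = m \<oplus> (b \<oplus> \<ominus> m \<oplus> \<ominus> b)"
    using mc b by (simp add: plus_simps)
  then show ?thesis
    using E(4)[OF ms(1) normal_add_invE[OF n b E(3)[OF ms(1)]]] by simp
qed

lemma star_mem_ideal:
  assumes M: "brace_ideal A M" and full: "M <+>\<^bsub>A\<^esub> brace_Soc A = carrier A"
    and a: "a \<in> carrier A" and b: "b \<in> carrier A"
  shows "brace_star A a b \<in> M"
proof -
  have n: "M \<lhd> add_monoid A" "M \<lhd> A"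
    and Ml: "\<And>a m. \<lbrakk>a \<in> carrier A; m \<in> M\<rbrakk> \<Longrightarrow> brace_lambda A a m \<in> M"
    using M by (auto simp: brace_ideal_def)
  note E = subgroup_addE[OF normal_imp_subgroup[OF n(1)]]
  obtain m s where ms: "m \<in> M" "s \<in> brace_Soc A" "a = m \<oplus> s"
    using a unfolding full[symmetric] by (auto simp: set_add_def set_mult_def)
  have mc: "m \<in> carrier A" and sc: "s \<in> carrier A" using ms E(1) Soc_carrier by auto
  \<comment> \<open>As a product, \<open>a\<close> acts through \<open>\<lambda>\<close> as
    \<open>m\<close> does, because \<open>\<lambda>\<close> of \<open>s\<close> is the
    identity.\<close>
  have "a = s \<otimes> m" using ms mc by (simp add: Soc_mult Soc_comm)
  then have lam: "brace_lambda A a b = brace_lambda A m b"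
    using mc sc b ms(2) by (simp add: lambda_mult Soc_lambda lambda_closed)
  \<comment> \<open>Chosen so that \<open>m \<otimes> b = b \<otimes> m'\<close>. Normality of
    \<open>M\<close> for \<open>\<otimes>\<close> keeps \<open>m'\<close> in \<open>M\<close>, and
    \<open>\<lambda>\<close> of \<open>b\<close> then turns it into an additive correction to
    \<open>b\<close>.\<close>
  define m' where "m' = inv b \<otimes> m \<otimes> b"
  have m': "m' \<in> M" unfolding m'_def by (rule normal.inv_op_closed1[OF n(2) b ms(1)])
  have m'c: "m' \<in> carrier A" using m' E(1) by auto
  have "m \<otimes> b = b \<otimes> m'"
    using mc b by (simp add: m'_def m_assoc[symmetric])
  then have "m \<otimes> b = b \<oplus> brace_lambda A b m'"
    using b m'c by (simp add: mult_eq)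
  \<comment> \<open>The bracket is an additive conjugate of an element of \<open>M\<close>, so the
    whole sum lies in \<open>M\<close>.\<close>
  then have "brace_star A a b = \<ominus> m \<oplus> (b \<oplus> brace_lambda A b m' \<oplus> \<ominus> b)"
    using mc b m'c lambda_closed[OF b m'c]
    by (simp add: brace_star_def lam lambda_eq[OF b, of m] a_minus_def plus_simps)
  then show ?thesis
    using E(4)[OF E(3)[OF ms(1)] normal_add_invE[OF n(1) b Ml[OF b m']]] by simp
qed

section \<open>The dichotomy and the radical\<close>

lemma maximal_ideal_cases:
  assumes M: "brace_maximal_ideal A M" and S: "\<not> brace_Soc A \<subseteq> M"
  shows "derived (add_monoid A) (carrier A) \<subseteq> M" "brace_square A \<subseteq> M"
proof -
  have id: "brace_ideal A M" using M by (simp add: brace_maximal_ideal_def)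
  then have sub: "subgroup M (add_monoid A)"
    using normal_imp_subgroup by (auto simp: brace_ideal_def)
  note full = maximal_ideal_add_Soc[OF M S]
  show "derived (add_monoid A) (carrier A) \<subseteq> M"
    unfolding derived_def
    using commutator_mem_ideal[OF id full]
    by (intro add.generate_subgroup_incl[OF _ sub]) (auto simp: a_inv_def)
  show "brace_square A \<subseteq> M"
    unfolding brace_square_def
    using star_mem_ideal[OF id full] by (intro add.generate_subgroup_incl[OF _ sub]) auto
qed

text \<open>Serves the case without maximal ideals, where the radical is the whole carrier.\<close>

lemma brace_square_carrier: "brace_square A \<subseteq> carrier A"
  unfolding brace_square_def
  by (rule add.generate_subgroup_incl[OF _ add.subgroup_self, simplified])
    (auto simp: brace_star_def lambda_closed a_minus_def plus_simps)

end

theorem theorem3p5: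
  fixes A :: "('a, 'm) ring_scheme"
  assumes "skew_left_brace A"
  shows "(\<forall>M. brace_maximal_ideal A M \<longrightarrow>
            derived (add_monoid A) (carrier A) <+>\<^bsub>A\<^esub> brace_square A \<subseteq> M \<or> brace_Soc A \<subseteq> M)
       \<and> brace_square A \<inter> brace_Soc A \<subseteq> brace_Rad A"
proof -
  interpret skew_left_brace A by fact
  have "derived (add_monoid A) (carrier A) <+>\<^bsub>A\<^esub> brace_square A \<subseteq> M"
    if M: "brace_maximal_ideal A M" "\<not> brace_Soc A \<subseteq> M" for M
  proof -
    have "subgroup M (add_monoid A)"
      using M normal_imp_subgroup by (auto simp: brace_ideal_def brace_maximal_ideal_def)
    then show ?thesis
      using maximal_ideal_cases[OF M] subgroup_addE(4)
      by (fastforce simp: set_add_def set_mult_def)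
  qed
  \<comment> \<open>Each maximal ideal contains the socle or \<open>brace_square A\<close>, hence in
    either case their intersection.\<close>
  moreover have "brace_square A \<inter> brace_Soc A \<subseteq> brace_Rad A"
    using maximal_ideal_cases(2) brace_square_carrier unfolding brace_Rad_def by auto
  ultimately show ?thesis by blast
qed

end
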